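(* Let $f:S^2\to\mathbb{R}^3$ be a $C^1$ embedding satisfying $f(-u)=-f(u)$ for all $u\in S^2$. Suppose further that $f$ is homotopic to the standard embedding $S^2\hookrightarrow\mathbb{R}^3$ via a $C^1$ homotopy $H:S^2\times[0,1]\to\mathbb{R}^3\setminus\{0\}$ satisfying $H(-u,t)=-H(u,t)$ for all $u\in S^2$ and $t\in[0,1]$. Then there is a cube in $\mathbb{R}^3$, with its centre at the origin, having all its vertices on the surface $f(S^2)$.
   Context: $S^2$ is the unit sphere of $\mathbb{R}^3$ and the standard embedding is the inclusion map $u\mapsto u$. That $H$ is a homotopy between $f$ and the standard embedding means $H(u,0)=f(u)$ and $H(u,1)=u$ for all $u\in S^2$. Cubes are non-degenerate (positive edge length) and may have any orientation in space. *)

theory Defs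
  imports "HOL-Analysis.Analysis"
begin

text \<open>
  A map on an arbitrary subset \<open>S\<close> of a normed space (such as a submanifold, possibly with
  boundary) is of class \<open>C\<^sup>1\<close> if around every point of \<open>S\<close> it extends to a continuously
  differentiable map on an open subset of the ambient space.
\<close>

definition C1_on :: "'a::real_normed_vector set \<Rightarrow> ('a \<Rightarrow> 'b::real_normed_vector) \<Rightarrow> bool" where
  "C1_on S f \<longleftrightarrow>
     (\<forall>x\<in>S. \<exists>U F (F' :: 'a \<Rightarrow> 'a \<Rightarrow>\<^sub>L 'b).
        open U \<and> x \<in> U \<and>
        (\<forall>y\<in>U. (F has_derivative blinfun_apply (F' y)) (at y)) \<and>
        continuous_on U F' \<and>
        (\<forall>y\<in>U \<inter> S. F y = f y))"

text \<open>
  An embedding is an immersion that is a homeomorphism onto its image. The orthogonal complement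
  of \<open>u\<close> is the tangent space of the unit sphere at \<open>u\<close>. A derivative \<open>D\<close> within the sphere is
  determined only on that tangent space, where it is the differential of \<open>f\<close>; hence the
  restriction in the injectivity condition.
\<close>

definition C1_embedding_sphere :: "(real^3 \<Rightarrow> real^3) \<Rightarrow> bool" where
  "C1_embedding_sphere f \<longleftrightarrow>
     C1_on (sphere 0 1) f \<and>
     (\<exists>g. homeomorphism (sphere 0 1) (f ` sphere 0 1) f g) \<and>
     (\<forall>u\<in>sphere 0 1. \<exists>D. (f has_derivative D) (at u within sphere 0 1) \<and>
        inj_on D {v. u \<bullet> v = 0})"

text \<open>
  Solid cubes with centre \<open>c\<close>, of any orientation; \<open>s\<close> is the edge length. Their vertices are
  their extreme points.
\<close>

definition cube_centred_at :: "real^3 \<Rightarrow> (real^3) set \<Rightarrow> bool" where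
  "cube_centred_at c C \<longleftrightarrow>
     (\<exists>s (Q :: real^3 \<Rightarrow> real^3). s > 0 \<and> orthogonal_transformation Q \<and>
        C = (\<lambda>x. c + s *\<^sub>R Q x) ` cbox (\<chi> i. - 1 / 2) (\<chi> i. 1 / 2))"

definition vertices :: "(real^3) set \<Rightarrow> (real^3) set" where
  "vertices C = {v. v extreme_point_of C}"

end

theory Submission
  imports Defs "HOL-Homology.Simplices"
begin

text \<open>
  Why the theorem holds. Let \<open>M\<close> be the surface. The homotopy shows that \<open>M\<close> separates \<open>0\<close> from
  infinity: otherwise the radial projection of \<open>M\<close> to the sphere would be null-homotopic by
  Borsuk's theorem, hence so would \<open>f / \<bar>f\<bar>\<close>, which \<open>H / \<bar>H\<bar>\<close> deforms to the identity
  (\<open>bounded_inside_of_sphere_homotopic_to_identity\<close>). The component \<open>K\<close> of \<open>0\<close> in the complement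
  of \<open>M\<close> is bounded and symmetric, so the signed distance to \<open>K\<close> is an even continuous function
  \<open>\<phi>\<close> that is negative at \<open>0\<close>, positive far away, and vanishes only on \<open>M\<close>
  (\<open>even_function_of_inside\<close>). It remains to find a cube with centre \<open>0\<close> on whose vertices
  \<open>\<phi>\<close> vanishes.

  Read \<open>q = (z, w)\<close> in \<open>\<complex>\<^sup>2\<close> as the quaternion \<open>z + w j\<close>. The map \<open>v \<mapsto> q v q\<^sup>*\<close> on \<open>\<real>\<^sup>3\<close>
  is a rotation scaled by \<open>\<bar>q\<bar>\<^sup>2\<close>, so every \<open>q \<noteq> 0\<close> gives a cube, the image of the cube with
  vertices \<open>(\<plusminus>1, \<plusminus>1, \<plusminus>1)\<close>. As \<open>\<phi>\<close> is even, only four vertices matter, one on each diagonal: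
  the task is to solve four equations in the four real coordinates of \<open>q\<close>. Right multiplication by
  \<open>e\<^sup>i\<^sup>\<pi>\<^sup>/\<^sup>4\<close> and by \<open>j\<close> (the maps \<open>turn\<close> and \<open>flip\<close>) generates a group of order 16 that acts
  freely away from \<open>0\<close> and permutes the diagonals as the dihedral group of order 8. The symmetry is
  what forces a solution. For an ellipsoid with three different axes the only solution is the
  cube aligned with the axes, that is, 24 placements under the rotation group of the cube, or
  \<open>24 / 8 = 3\<close> orbits of the dihedral group. This number is odd, and its parity is the same for
  every generic \<open>\<phi>\<close>; a smaller group of permutations of the diagonals would only see an even number.

  The parity argument is carried out in the manner of Sperner's lemma. Give \<open>q\<close> the label \<open>4\<close> if
  \<open>\<phi>\<close> is nowhere positive on the vertices of its cube, and otherwise the index in \<open>{0, 1, 2, 3}\<close>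
  of a diagonal on which \<open>\<phi>\<close> is positive. If the vertex realising the label is selected
  depending only on the set of vertices of the cube, the group permutes the labels. A point near which
  all five labels occur is a solution. To find one, count modulo 2 the rainbow simplices, those whose vertices
  carry all five labels, in a singular 4-chain. A 5-simplex has an even number of rainbow
  faces, so the count is a cocycle modulo 2 (\<open>even_rainbow_count_boundary\<close>) and barycentric
  subdivision can change the parity only through the boundary of the chain
  (\<open>even_rainbow_count_iterated_subdivision\<close>). The chain consists of five cones with apex \<open>0\<close>,
  whose bases are tetrahedra far from \<open>0\<close>. Modulo 2 and the group, these form the fundamental
  cycle of the quotient of a 3-sphere. The bases contribute nothing because the label \<open>4\<close> does not occur far away, and
  the other faces cancel in pairs under the group. Since the chain itself has an odd count, so has every
  iterated subdivision, and arbitrarily small rainbow simplices exist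
  (\<open>equivariant_labelling_rainbow_point\<close>).
\<close>

section \<open>Subdivision is naturally chain homotopic to the identity\<close>

text \<open>
  Cancelling boundary faces against their images under a group needs a chain homotopy that
  commutes with every map of spaces. It is therefore defined on the standard simplex, as \<open>subd\<close>,
  and transported along each singular simplex.
\<close>
definition subdivision_homotopy :: "nat \<Rightarrow> 'a chain \<Rightarrow> 'a chain" where
  "subdivision_homotopy p =
     frag_extend (\<lambda>f. chain_map (Suc p) f (subd p (frag_of (restrict id (standard_simplex p)))))"

lemma subdivision_homotopy_diff:
  "subdivision_homotopy p (c - d) = subdivision_homotopy p c - subdivision_homotopy p d"
  by (simp add: subdivision_homotopy_def frag_extend_diff)

lemma subdivision_homotopy_0 [simp]: "subdivision_homotopy p 0 = 0"
  by (simp add: subdivision_homotopy_def)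

lemma chain_map_simplex_map:
  assumes "simplicial_chain q (standard_simplex p) c"
  shows "chain_map q (simplex_map p g f) c = chain_map q g (chain_map q f c)"
  using assms unfolding simplicial_chain_def
proof (induction rule: frag_induction)
  case (one s)
  then have "simplex_map q (simplex_map p g f) s = simplex_map q g (simplex_map q f s)"
    by (force simp: simplex_map_def restrict_compose_left simplicial_simplex)
  then show ?case
    by simp
qed (auto simp: chain_map_diff)

lemma simplicial_chain_subd_id:
  "simplicial_chain (Suc p) (standard_simplex p) (subd p (frag_of (restrict id (standard_simplex p))))"
  by (simp add: chain_homotopic_simplicial_subdivision2)

lemma singular_chain_subdivision_homotopy:
  assumes "singular_chain p X c"
  shows "singular_chain (Suc p) X (subdivision_homotopy p c)"
  unfolding subdivision_homotopy_def
proof (rule singular_chain_extend)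
  fix f
  assume "f \<in> Poly_Mapping.keys c"
  with assms have "singular_simplex p X f"
    by (auto simp: singular_chain_def)
  then show "singular_chain (Suc p) X
               (chain_map (Suc p) f (subd p (frag_of (restrict id (standard_simplex p)))))"
    using singular_chain_chain_map simplicial_chain_subd_id simplicial_imp_singular_chain
    unfolding singular_simplex_def by blast
qed

lemma naturality_subdivision_homotopy:
  assumes "singular_chain p X c"
  shows "subdivision_homotopy p (chain_map p g c) = chain_map (Suc p) g (subdivision_homotopy p c)"
  using assms unfolding singular_chain_def
proof (induction rule: frag_induction)
  case (one f)
  then show ?case
    by (simp add: subdivision_homotopy_def chain_map_simplex_map [OF simplicial_chain_subd_id])
qed (auto simp: chain_map_diff subdivision_homotopy_diff)

lemma subdivision_homotopy_simplicial:
  assumes "simplicial_chain p (standard_simplex r) c"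
  shows "subdivision_homotopy p c = subd p c"
  using assms unfolding simplicial_chain_def
proof (induction rule: frag_induction)
  case (one g)
  then have g: "simplicial_simplex p (standard_simplex r) g"
    by simp
  then have "simplex_map p g (restrict id (standard_simplex p)) = g"
    by (auto simp: simplicial_simplex_def singular_simplex_def simplex_map_def
        extensional_restrict fun_eq_iff restrict_def extensional_def)
  then show ?case
    using chain_homotopic_simplicial_subdivision1 [of p p "frag_of (restrict id (standard_simplex p))" r g] g
    by (simp add: subdivision_homotopy_def)
qed (auto simp: subdivision_homotopy_diff)

text \<open>
  The formula holds for the identity of the standard simplex by the properties of \<open>subd\<close>, and
  naturality pushes it forward along a singular simplex. The boundary term needs
  \<open>subdivision_homotopy_simplicial\<close>: on faces of the standard simplex, transporting \<open>subd\<close>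
  agrees with \<open>subd\<close> itself.
\<close>
lemma chain_boundary_subdivision_homotopy:
  assumes "singular_chain p X c" "0 < p"
  shows "chain_boundary (Suc p) (subdivision_homotopy p c)
         = singular_subdivision p c - c - subdivision_homotopy (p - 1) (chain_boundary p c)"
  using assms(1) unfolding singular_chain_def
proof (induction rule: frag_induction)
  case (one f)
  let ?\<iota> = "frag_of (restrict id (standard_simplex p))"
  let ?X = "subtopology (powertop_real UNIV) (standard_simplex p)"
  have f: "singular_simplex p X f"
    using one by simp
  have \<iota>: "simplicial_chain p (standard_simplex p) ?\<iota>"
    by simp
  have sing\<iota>: "singular_chain p ?X ?\<iota>"
    using \<iota> simplicial_imp_singular_chain by blast
  have f\<iota>: "chain_map p f ?\<iota> = frag_of f"
    using f singular_simplex_chain_map_id by (metis chain_map_of)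
  have bd: "simplicial_chain (p - 1) (standard_simplex p) (chain_boundary p ?\<iota>)"
    using simplicial_chain_boundary [OF \<iota>] by simp
  have "chain_boundary (Suc p) (subdivision_homotopy p (frag_of f))
        = chain_map p f (chain_boundary (Suc p) (subd p ?\<iota>))"
    using chain_boundary_chain_map [OF simplicial_imp_singular_chain [OF simplicial_chain_subd_id]]
    by (simp add: subdivision_homotopy_def)
  also have "\<dots> = chain_map p f (simplicial_subdivision p ?\<iota>) - frag_of f
                  - chain_map p f (subd (p - 1) (chain_boundary p ?\<iota>))"
    using chain_homotopic_simplicial_subdivision3 [OF \<iota>] by (simp add: chain_map_diff f\<iota> [simplified])
  also have "chain_map p f (subd (p - 1) (chain_boundary p ?\<iota>))
             = chain_map p f (subdivision_homotopy (p - 1) (chain_boundary p ?\<iota>))"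
    using subdivision_homotopy_simplicial [OF bd] by simp
  also have "\<dots> = subdivision_homotopy (p - 1) (chain_map (p - 1) f (chain_boundary p ?\<iota>))"
    using naturality_subdivision_homotopy [OF simplicial_imp_singular_chain [OF bd], where g = f] \<open>0 < p\<close> by simp
  also have "chain_map (p - 1) f (chain_boundary p ?\<iota>) = chain_boundary p (frag_of f)"
    using chain_boundary_chain_map [OF sing\<iota>] f\<iota> by (metis One_nat_def)
  finally show ?case
    by (simp add: singular_subdivision_def id_def del: restrict_apply)
next
  case (diff a b)
  show ?case
    unfolding chain_boundary_diff singular_subdivision_diff subdivision_homotopy_diff diff
    by (simp add: algebra_simps)
qed simp

section \<open>Parity of the number of rainbow simplices\<close>

definition rainbow :: "nat \<Rightarrow> (nat \<Rightarrow> nat) \<Rightarrow> bool" where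
  "rainbow p l \<longleftrightarrow> {..p} \<subseteq> l ` {..p}"

definition skip :: "nat \<Rightarrow> nat \<Rightarrow> nat" where
  "skip k j = (if j < k then j else Suc j)"

lemma image_skip: "k \<le> Suc p \<Longrightarrow> skip k ` {..p} = {..Suc p} - {k}"
proof -
  assume k: "k \<le> Suc p"
  have "x \<in> skip k ` {..p}" if "x \<le> Suc p" "x \<noteq> k" for x
    using that k by (intro image_eqI [of _ _ "if x < k then x else x - 1"]) (auto simp: skip_def)
  then show ?thesis
    using k by (auto simp: skip_def split: if_splits)
qed

text \<open>
  The combinatorial step of Sperner's lemma. If the face opposite to the vertex \<open>k\<close> is rainbow, it
  carries each label exactly once, so the label of \<open>k\<close> is repeated at exactly one other vertex \<open>m\<close>,
  and the rainbow faces are exactly those opposite to \<open>k\<close> and to \<open>m\<close>.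
\<close>
lemma even_card_rainbow_faces:
  assumes "\<And>j. l j \<le> p"
  shows "even (card {k. k \<le> Suc p \<and> rainbow p (l \<circ> skip k)})"
proof -
  let ?R = "{k. k \<le> Suc p \<and> {..p} \<subseteq> l ` ({..Suc p} - {k})}"
  have "(l \<circ> skip k) ` {..p} = l ` ({..Suc p} - {k})" if "k \<le> Suc p" for k
    using that by (metis image_comp image_skip)
  then have eq: "{k. k \<le> Suc p \<and> rainbow p (l \<circ> skip k)} = ?R"
    unfolding rainbow_def by auto
  show ?thesis
  proof (cases "?R = {}")
    case True
    show ?thesis
      unfolding eq True by simp
  next
    case False
    then obtain k where k: "k \<le> Suc p" and cover: "{..p} \<subseteq> l ` ({..Suc p} - {k})"
      by auto
    have inj: "inj_on l ({..Suc p} - {k})"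
    proof (rule eq_card_imp_inj_on)
      have "l ` ({..Suc p} - {k}) = {..p}"
        using cover assms by auto
      then show "card (l ` ({..Suc p} - {k})) = card ({..Suc p} - {k})"
        using k by simp
    qed auto
    obtain m where m: "m \<le> Suc p" "m \<noteq> k" "l m = l k"
    proof -
      have "l k \<in> l ` ({..Suc p} - {k})"
        using cover assms by blast
      then obtain m where "m \<in> {..Suc p} - {k}" "l m = l k"
        by (metis imageE)
      then show ?thesis
        using that [of m] by simp
    qed
    have unique: "j = m" if "j \<le> Suc p" "j \<noteq> k" "l j = l k" for j
      using that m by - (rule inj_onD [OF inj], simp_all)
    have cover': "{..p} \<subseteq> l ` ({..Suc p} - {m})"
    proof
      fix y
      assume "y \<in> {..p}"
      with cover obtain i where "y = l i" "i \<in> {..Suc p} - {k}"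
        by (meson imageE subsetD)
      then have "y = l (if i = m then k else i)" "(if i = m then k else i) \<in> {..Suc p} - {m}"
        using k m by auto
      then show "y \<in> l ` ({..Suc p} - {m})"
        by (rule image_eqI)
    qed
    have "j = k \<or> j = m" if j: "j \<le> Suc p" "{..p} \<subseteq> l ` ({..Suc p} - {j})" for j
    proof (rule ccontr)
      assume nj: "\<not> (j = k \<or> j = m)"
      have "l j \<in> l ` ({..Suc p} - {j})"
        using j(2) assms by blast
      then obtain i where "i \<in> {..Suc p} - {j}" "l j = l i"
        by (rule imageE)
      then have i: "i \<le> Suc p" "i \<noteq> j" "l i = l j"
        by auto
      show False
      proof (cases "i = k")
        case True
        then show False
          using unique [OF j(1)] i(3) nj by metis
      next
        case False
        then have "i = j"
          using inj i(1,3) j(1) nj by - (rule inj_onD [OF inj], simp_all)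
        with i(2) show False ..
      qed
    qed
    then have "?R = {k, m}"
      using k m(1) cover cover' by blast
    with m show ?thesis
      by (simp add: eq)
  qed
qed

definition vertex :: "nat \<Rightarrow> nat \<Rightarrow> real" where
  "vertex j = (\<lambda>i. if i = j then 1 else 0)"

lemma vertex_in_standard_simplex [simp]: "vertex j \<in> standard_simplex p \<longleftrightarrow> j \<le> p"
  using basis_in_standard_simplex [of j p] unfolding vertex_def by (simp add: eq_commute)

text \<open>
  Rainbow simplices are counted with their coefficients, so the count is additive; only its parity
  is meaningful. Reading it off from a chain over a one-point set makes the linearity
  of \<open>frag_extend\<close> available.
\<close>
definition rainbow_count :: "('a \<Rightarrow> nat) \<Rightarrow> nat \<Rightarrow> 'a chain \<Rightarrow> int" where
  "rainbow_count lab p c =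
     Poly_Mapping.lookup (frag_extend (\<lambda>s. if rainbow p (\<lambda>j. lab (s (vertex j))) then frag_of () else 0) c) ()"

lemma rainbow_count_0 [simp]: "rainbow_count lab p 0 = 0"
  by (simp add: rainbow_count_def)

lemma rainbow_count_of:
  "rainbow_count lab p (frag_of s) = of_bool (rainbow p (\<lambda>j. lab (s (vertex j))))"
  by (simp add: rainbow_count_def)

lemma rainbow_count_diff: "rainbow_count lab p (c - d) = rainbow_count lab p c - rainbow_count lab p d"
  by (simp add: rainbow_count_def frag_extend_diff lookup_minus)

lemma rainbow_count_minus: "rainbow_count lab p (- c) = - rainbow_count lab p c"
  using rainbow_count_diff [of lab p 0 c] by simp

lemma rainbow_count_add: "rainbow_count lab p (c + d) = rainbow_count lab p c + rainbow_count lab p d"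
  using rainbow_count_diff [of lab p c "- d"] by (simp add: rainbow_count_minus)

lemma rainbow_count_sum: "rainbow_count lab p (sum f I) = (\<Sum>i\<in>I. rainbow_count lab p (f i))"
  by (induction I rule: infinite_finite_induct) (auto simp: rainbow_count_add)

lemma rainbow_count_cmul_sign:
  "rainbow_count lab p (frag_cmul ((-1) ^ k) c) = (-1) ^ k * rainbow_count lab p c"
  by (cases "even k") (auto simp: rainbow_count_minus)

lemma rainbow_count_eq_0:
  assumes "\<And>s. s \<in> Poly_Mapping.keys c \<Longrightarrow> \<not> rainbow p (\<lambda>j. lab (s (vertex j)))"
  shows "rainbow_count lab p c = 0"
proof -
  have "Poly_Mapping.keys c \<subseteq> {s. \<not> rainbow p (\<lambda>j. lab (s (vertex j)))}"
    using assms by auto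
  then show ?thesis
    by (induction rule: frag_induction) (auto simp: rainbow_count_of rainbow_count_diff)
qed

lemma singular_face_vertex:
  assumes "j \<le> p"
  shows "singular_face (Suc p) k s (vertex j) = s (vertex (skip k j))"
proof -
  have "simplical_face k (vertex j) = vertex (skip k j)"
    by (auto simp: simplical_face_def vertex_def skip_def fun_eq_iff)
  with assms show ?thesis
    by (simp add: singular_face_def)
qed

lemma rainbow_cong: "(\<And>j. j \<le> p \<Longrightarrow> l j = l' j) \<Longrightarrow> rainbow p l \<longleftrightarrow> rainbow p l'"
  unfolding rainbow_def by (metis (no_types, lifting) atMost_iff image_cong)

lemma even_rainbow_count_boundary:
  assumes "\<And>x. lab x \<le> p"
  shows "even (rainbow_count lab p (chain_boundary (Suc p) c))"
  using subset_UNIV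
proof (induction c rule: frag_induction)
  case (one s)
  let ?r = "\<lambda>k. rainbow p ((\<lambda>j. lab (s (vertex j))) \<circ> skip k)"
  have "rainbow_count lab p (frag_of (singular_face (Suc p) k s)) = of_bool (?r k)" for k
    unfolding rainbow_count_of
    by (intro arg_cong [where f = of_bool] rainbow_cong) (simp add: singular_face_vertex)
  then have "rainbow_count lab p (chain_boundary (Suc p) (frag_of s))
             = (\<Sum>k\<le>Suc p. (-1) ^ k * of_bool (?r k))"
    by (simp add: chain_boundary_of rainbow_count_sum rainbow_count_cmul_sign del: sum.atMost_Suc)
  also have "even \<dots> \<longleftrightarrow> even (card {k. k \<le> Suc p \<and> ?r k})"
    by (simp add: even_sum_iff del: sum.atMost_Suc)
  finally show ?case
    using even_card_rainbow_faces [of "\<lambda>j. lab (s (vertex j))" p] assms by (simp add: o_def)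
qed (auto simp: chain_boundary_diff rainbow_count_diff)

text \<open>
  Being rainbow does not depend on the names of the labels, so a map that permutes the labels
  preserves the count.
\<close>
lemma rainbow_count_chain_map:
  assumes "\<And>x. lab (g x) = \<pi> (lab x)" "bij_betw \<pi> {..p} {..p}"  "\<And>x. lab x \<le> p"
  shows "rainbow_count lab p (chain_map p g c) = rainbow_count lab p c"
  using subset_UNIV
proof (induction c rule: frag_induction)
  case (one s)
  let ?l = "\<lambda>j. lab (s (vertex j))"
  have "rainbow p (\<lambda>j. lab (simplex_map p g s (vertex j))) \<longleftrightarrow> rainbow p (\<pi> \<circ> ?l)"
    by (rule rainbow_cong) (simp add: simplex_map_def assms)
  also have "\<dots> \<longleftrightarrow> rainbow p ?l"
  proof -
    have l: "?l ` {..p} \<subseteq> {..p}"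
      using assms by auto
    have "rainbow p (\<pi> \<circ> ?l) \<longleftrightarrow> \<pi> ` {..p} \<subseteq> \<pi> ` ?l ` {..p}"
      using assms(2) by (simp add: rainbow_def image_comp bij_betw_def)
    also have "\<dots> \<longleftrightarrow> {..p} \<subseteq> ?l ` {..p}"
      using assms(2) l by (meson bij_betw_def inj_on_image_subset_iff order_refl)
    finally show ?thesis
      by (simp add: rainbow_def)
  qed
  finally show ?case
    by (simp add: rainbow_count_of)
qed (auto simp: chain_map_diff rainbow_count_diff)

lemma rainbow_count_missing_label:
  assumes "singular_chain p (top_of_set S) c" "i \<le> p" "\<And>x. x \<in> S \<Longrightarrow> lab x \<noteq> i"
  shows "rainbow_count lab p c = 0"
proof (rule rainbow_count_eq_0)
  fix s
  assume "s \<in> Poly_Mapping.keys c"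
  then have "singular_simplex p (top_of_set S) s"
    using assms(1) by (auto simp: singular_chain_def)
  then have "s (vertex j) \<in> S" if "j \<le> p" for j
    using that by (auto simp: singular_simplex_def continuous_map_def topspace_standard_simplex Pi_iff)
  then have "i \<notin> (\<lambda>j. lab (s (vertex j))) ` {..p}"
    using assms(3) by auto
  then show "\<not> rainbow p (\<lambda>j. lab (s (vertex j)))"
    using assms(2) unfolding rainbow_def by (meson atMost_iff subsetD)
qed

section \<open>Rainbow parity and iterated subdivision\<close>

lemma subdivision_homotopy_add:
  "subdivision_homotopy p (c + d) = subdivision_homotopy p c + subdivision_homotopy p d"
  by (simp add: subdivision_homotopy_def frag_extend_add)

lemma iterated_subdivision_add:
  "(singular_subdivision p ^^ n) (c + d) = (singular_subdivision p ^^ n) c + (singular_subdivision p ^^ n) d"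
  by (induction n) (auto simp: singular_subdivision_add)

lemma singular_chain_iterated_subdivision:
  "singular_chain p X c \<Longrightarrow> singular_chain p X ((singular_subdivision p ^^ n) c)"
  by (induction n) (auto simp: singular_chain_singular_subdivision)

lemma chain_boundary_iterated_subdivision:
  "singular_chain p X c \<Longrightarrow>
   chain_boundary p ((singular_subdivision p ^^ n) c) = (singular_subdivision (p - 1) ^^ n) (chain_boundary p c)"
  by (induction n)
    (auto simp: chain_boundary_singular_subdivision [OF singular_chain_iterated_subdivision])

lemma naturality_iterated_subdivision:
  "singular_chain p X c \<Longrightarrow>
   (singular_subdivision p ^^ n) (chain_map p g c) = chain_map p g ((singular_subdivision p ^^ n) c)"
  by (induction n)
    (auto simp: naturality_singular_subdivision [OF singular_chain_iterated_subdivision])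

text \<open>
  If \<open>c\<close> is the boundary of a chain, this is, modulo 2, the change of the rainbow count of that
  chain from its \<open>n\<close>-th subdivision to the next one. Being additive in \<open>c\<close>, it can be computed
  face by face.
\<close>
definition homotopy_count :: "('a \<Rightarrow> nat) \<Rightarrow> nat \<Rightarrow> nat \<Rightarrow> 'a chain \<Rightarrow> int" where
  "homotopy_count lab p n c =
     rainbow_count lab (Suc p) (subdivision_homotopy p ((singular_subdivision p ^^ n) c))"

lemma additive_homotopy_count: "Modules.additive (homotopy_count lab p n)"
  by (simp add: Modules.additive_def homotopy_count_def iterated_subdivision_add subdivision_homotopy_add
      rainbow_count_add)

lemma homotopy_count_chain_map:
  assumes "\<And>x. lab (g x) = \<pi> (lab x)" "bij_betw \<pi> {..Suc p} {..Suc p}" "\<And>x. lab x \<le> Suc p"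
    and "singular_chain p X c"
  shows "homotopy_count lab p n (chain_map p g c) = homotopy_count lab p n c"
  unfolding homotopy_count_def naturality_iterated_subdivision [OF assms(4)]
    naturality_subdivision_homotopy [OF singular_chain_iterated_subdivision [OF assms(4)]]
  by (rule rainbow_count_chain_map) (use assms in auto)

lemma homotopy_count_missing_label:
  assumes "singular_chain p (top_of_set S) c" "i \<le> Suc p" "\<And>x. x \<in> S \<Longrightarrow> lab x \<noteq> i"
  shows "homotopy_count lab p n c = 0"
  unfolding homotopy_count_def
  by (rule rainbow_count_missing_label [OF _ assms(2,3)])
    (simp_all add: singular_chain_subdivision_homotopy singular_chain_iterated_subdivision assms(1))

text \<open>
  By the homotopy formula, subdividing once more changes a chain by a boundary, which has an even
  count, and by the homotopy applied to its own boundary.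
\<close>
lemma even_rainbow_count_iterated_subdivision:
  assumes "singular_chain (Suc p) X c" "\<And>x. lab x \<le> Suc p"
    and "\<And>n. even (homotopy_count lab p n (chain_boundary (Suc p) c))"
  shows "even (rainbow_count lab (Suc p) ((singular_subdivision (Suc p) ^^ n) c))
         \<longleftrightarrow> even (rainbow_count lab (Suc p) c)"
proof (induction n)
  case (Suc n)
  let ?c = "(singular_subdivision (Suc p) ^^ n) c"
  have c: "singular_chain (Suc p) X ?c"
    by (rule singular_chain_iterated_subdivision [OF assms(1)])
  have "singular_subdivision (Suc p) ?c = ?c + subdivision_homotopy p (chain_boundary (Suc p) ?c)
          + chain_boundary (Suc (Suc p)) (subdivision_homotopy (Suc p) ?c)"
    using chain_boundary_subdivision_homotopy [OF c] by (simp add: algebra_simps)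
  then have "rainbow_count lab (Suc p) (singular_subdivision (Suc p) ?c)
             = rainbow_count lab (Suc p) ?c + homotopy_count lab p n (chain_boundary (Suc p) c)
               + rainbow_count lab (Suc p) (chain_boundary (Suc (Suc p)) (subdivision_homotopy (Suc p) ?c))"
    by (simp add: rainbow_count_add homotopy_count_def chain_boundary_iterated_subdivision [OF assms(1)])
  then show ?case
    using Suc assms(3) even_rainbow_count_boundary [of lab "Suc p"] assms(2) by simp
qed simp

section \<open>Affine simplices\<close>

definition affine_simplex :: "nat \<Rightarrow> (nat \<Rightarrow> 'a) \<Rightarrow> (nat \<Rightarrow> real) \<Rightarrow> 'a::real_vector" where
  "affine_simplex p v = (\<lambda>x\<in>standard_simplex p. \<Sum>j\<le>p. x j *\<^sub>R v j)"

lemma affine_simplex_vertex: "j \<le> p \<Longrightarrow> affine_simplex p v (vertex j) = v j"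
  by (simp add: affine_simplex_def) (simp add: vertex_def if_distrib [of "\<lambda>t. t *\<^sub>R _"] cong: if_cong)

lemma simplex_map_affine_simplex:
  assumes "linear g"
  shows "simplex_map p g (affine_simplex p v) = affine_simplex p (g \<circ> v)"
  by (auto simp: simplex_map_def affine_simplex_def fun_eq_iff linear_sum [OF assms] linear_cmul [OF assms])

lemma singular_face_affine_simplex:
  assumes "k \<le> Suc p"
  shows "singular_face (Suc p) k (affine_simplex (Suc p) v) = affine_simplex p (v \<circ> skip k)"
proof
  fix x :: "nat \<Rightarrow> real"
  show "singular_face (Suc p) k (affine_simplex (Suc p) v) x = affine_simplex p (v \<circ> skip k) x"
  proof (cases "x \<in> standard_simplex p")
    case True
    have "(\<Sum>j\<le>Suc p. simplical_face k x j *\<^sub>R v j) = (\<Sum>j\<in>{..Suc p} - {k}. simplical_face k x j *\<^sub>R v j)"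
      using assms by (intro sum.mono_neutral_right) (auto simp: simplical_face_def)
    also have "\<dots> = (\<Sum>j\<le>p. simplical_face k x (skip k j) *\<^sub>R v (skip k j))"
      unfolding image_skip [OF assms, symmetric]
      by (subst sum.reindex) (auto simp: inj_on_def skip_def split: if_splits)
    also have "\<dots> = (\<Sum>j\<le>p. x j *\<^sub>R v (skip k j))"
      by (intro sum.cong) (auto simp: simplical_face_def skip_def)
    finally show ?thesis
      using True simplical_face_in_standard_simplex [of "Suc p" k x] assms
      by (simp add: singular_face_def affine_simplex_def)
  next
    case False
    then show ?thesis
      by (simp add: singular_face_def affine_simplex_def)
  qed
qed

lemma singular_simplex_affine_simplex:
  fixes v :: "nat \<Rightarrow> 'a::real_normed_vector"
  assumes "convex S" "\<And>j. j \<le> p \<Longrightarrow> v j \<in> S"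
  shows "singular_simplex p (top_of_set S) (affine_simplex p v)"
proof -
  let ?\<Delta> = "subtopology (powertop_real UNIV) (standard_simplex p)"
  have "continuous_map ?\<Delta> euclidean (\<lambda>x. \<Sum>j\<le>p. x j *\<^sub>R v j)"
  proof (intro continuous_map_sum)
    fix j
    have "continuous_map ?\<Delta> euclideanreal (\<lambda>x. x j)"
      by (intro continuous_map_from_subtopology continuous_map_product_projection) auto
    then have "continuous_map ?\<Delta> euclidean ((\<lambda>t. t *\<^sub>R v j) \<circ> (\<lambda>x. x j))"
      by (rule continuous_map_compose) (simp add: continuous_intros)
    then show "continuous_map ?\<Delta> euclidean (\<lambda>x. x j *\<^sub>R v j)"
      by (simp add: o_def)
  qed auto
  moreover have "(\<Sum>j\<le>p. x j *\<^sub>R v j) \<in> S" if "x \<in> standard_simplex p" for x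
    using that assms by (intro convex_sum) (auto simp: standard_simplex_def)
  ultimately have "continuous_map ?\<Delta> (top_of_set S) (affine_simplex p v)"
    by (auto simp: affine_simplex_def continuous_map_in_subtopology topspace_standard_simplex
        elim: continuous_map_eq)
  then show ?thesis
    by (simp add: singular_simplex_def affine_simplex_def)
qed

definition vertex_simplex :: "'a list \<Rightarrow> (nat \<Rightarrow> real) \<Rightarrow> 'a::real_vector" where
  "vertex_simplex vs = affine_simplex (length vs - 1) ((!) vs)"

lemma affine_simplex_cong:
  "(\<And>j. j \<le> p \<Longrightarrow> v j = v' j) \<Longrightarrow> affine_simplex p v = affine_simplex p v'"
  unfolding affine_simplex_def by (intro restrict_ext sum.cong) auto

lemma chain_boundary_simplex:
  "chain_boundary 4 (frag_of (vertex_simplex [u, a, b, c, d]))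
   = frag_of (vertex_simplex [a, b, c, d]) - frag_of (vertex_simplex [u, b, c, d]) + frag_of (vertex_simplex [u, a, c, d])
     - frag_of (vertex_simplex [u, a, b, d]) + frag_of (vertex_simplex [u, a, b, c])"
proof -
  have face: "singular_face 4 k (vertex_simplex [u, a, b, c, d]) = vertex_simplex (map ((!) [u, a, b, c, d] \<circ> skip k) [0..<4])"
    if "k \<le> 4" for k
  proof -
    have "singular_face 4 k (vertex_simplex [u, a, b, c, d]) = affine_simplex 3 ((!) [u, a, b, c, d] \<circ> skip k)"
      using singular_face_affine_simplex [of k 3 "(!) [u, a, b, c, d]"] that
      by (simp add: vertex_simplex_def eval_nat_numeral)
    also have "\<dots> = vertex_simplex (map ((!) [u, a, b, c, d] \<circ> skip k) [0..<4])"
      unfolding vertex_simplex_def by (simp del: upt.simps, rule affine_simplex_cong) (simp del: upt.simps)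
    finally show ?thesis .
  qed
  have "{..4::nat} = {0, 1, 2, 3, 4}"
    by auto
  then show ?thesis
    by (simp add: chain_boundary_of face) (simp add: skip_def upt_rec numeral_eq_Suc)
qed

lemma simplex_map_simplex:
  assumes "linear g" "length vs = Suc p"
  shows "simplex_map p g (vertex_simplex vs) = vertex_simplex (map g vs)"
  unfolding vertex_simplex_def length_map assms(2) diff_Suc_1 simplex_map_affine_simplex [OF assms(1)]
  by (rule affine_simplex_cong) (use assms(2) in \<open>simp add: less_Suc_eq_le [symmetric]\<close>)

lemma singular_chain_simplex:
  fixes vs :: "'a::real_normed_vector list"
  assumes "convex S" "set vs \<subseteq> S" "length vs = Suc p"
  shows "singular_chain p (top_of_set S) (frag_of (vertex_simplex vs))"
  using assms unfolding vertex_simplex_def singular_chain_of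
  by (auto intro!: singular_simplex_affine_simplex simp: subset_iff)

lemma rainbow_count_simplex:
  assumes "length vs = Suc p"
  shows "rainbow_count lab p (frag_of (vertex_simplex vs)) = of_bool ({..p} \<subseteq> lab ` set vs)"
proof -
  have "rainbow p (\<lambda>j. lab (vertex_simplex vs (vertex j))) \<longleftrightarrow> rainbow p (\<lambda>j. lab (vs ! j))"
    by (rule rainbow_cong) (simp add: vertex_simplex_def assms affine_simplex_vertex)
  moreover have "(\<lambda>j. lab (vs ! j)) ` {..p} = lab ` set vs"
    using assms by (auto simp: set_conv_nth image_iff less_Suc_eq_le) 
  ultimately show ?thesis
    by (simp add: rainbow_count_of rainbow_def)
qed

section \<open>Labellings compatible with a group of order 16\<close>

text \<open>
  Right multiplication of the quaternion \<open>z + w j\<close> by \<open>e\<^sup>i\<^sup>\<pi>\<^sup>/\<^sup>4\<close> and by \<open>j\<close>. The corresponding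
  permutations of the labels are \<open>i \<mapsto> i - 1\<close> and \<open>i \<mapsto> 1 - i\<close> modulo 4, with \<open>4\<close> fixed.
\<close>
definition turn :: "complex \<times> complex \<Rightarrow> complex \<times> complex" where
  "turn q = (cis (pi / 4) * fst q, cis (- (pi / 4)) * snd q)"

definition flip :: "complex \<times> complex \<Rightarrow> complex \<times> complex" where
  "flip q = (- snd q, fst q)"

definition turn_label :: "nat \<Rightarrow> nat" where
  "turn_label i = (if i < 4 then (i + 3) mod 4 else i)"

definition flip_label :: "nat \<Rightarrow> nat" where
  "flip_label i = (if i < 4 then (5 - i) mod 4 else i)"

lemma linear_turn: "linear turn"
  by (rule linearI) (simp_all add: turn_def algebra_simps scaleR_conv_of_real)

lemma linear_flip: "linear flip"
  by (rule linearI) (simp_all add: flip_def)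

lemma atMost_4: "{..4} = {0, 1, 2, 3, 4::nat}"
  by auto

lemma bij_turn_label: "bij_betw turn_label {..4} {..4}"
  by (auto simp: atMost_4 bij_betw_def turn_label_def)

lemma bij_flip_label: "bij_betw flip_label {..4} {..4}"
  by (auto simp: atMost_4 bij_betw_def flip_label_def)

text \<open>
  The orbit of \<open>(R, 0)\<close> under the group: two regular octagons in orthogonal planes. Their join is
  a 3-sphere triangulated by tetrahedra spanned by an edge of each octagon.
\<close>
definition zpoint :: "real \<Rightarrow> nat \<Rightarrow> complex \<times> complex" where
  "zpoint R k = (of_real R * cis (real k * pi / 4), 0)"

definition wpoint :: "real \<Rightarrow> nat \<Rightarrow> complex \<times> complex" where
  "wpoint R k = (0, of_real R * cis (real k * pi / 4))"

lemma turn_zpoint: "turn (zpoint R k) = zpoint R (Suc k)"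
  by (simp add: turn_def zpoint_def cis_mult mult.left_commute [of "cis _"] ring_distribs add_divide_distrib)

lemma turn_wpoint: "turn (wpoint R (Suc k)) = wpoint R k"
  by (simp add: turn_def wpoint_def cis_mult mult.left_commute [of "cis _"] ring_distribs add_divide_distrib)

lemma flip_zpoint: "flip (zpoint R k) = wpoint R k"
  by (simp add: flip_def zpoint_def wpoint_def)

lemma flip_wpoint: "flip (wpoint R k) = zpoint R (k + 4)"
proof -
  have "cis (real (k + 4) * pi / 4) = cis (real k * pi / 4) * cis pi"
    unfolding cis_mult by (simp add: ring_distribs add_divide_distrib)
  then show ?thesis
    by (simp add: flip_def zpoint_def wpoint_def)
qed

lemma point_period:
  "zpoint R (k + 8) = zpoint R k" "wpoint R (k + 8) = wpoint R k"
proof -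
  have "cis (real (k + 8) * pi / 4) = cis (real k * pi / 4) * cis (2 * pi)"
    unfolding cis_mult by (simp add: ring_distribs add_divide_distrib)
  then show "zpoint R (k + 8) = zpoint R k" "wpoint R (k + 8) = wpoint R k"
    by (simp_all add: zpoint_def wpoint_def)
qed

lemma norm_point [simp]:
  assumes "0 \<le> R" shows "norm (zpoint R k) = R" "norm (wpoint R k) = R"
  using assms by (simp_all add: zpoint_def wpoint_def norm_Pair norm_mult)

lemma inner_point:
  "zpoint R j \<bullet> zpoint R k = R\<^sup>2 * cos (real j * pi / 4 - real k * pi / 4)"
  "wpoint R j \<bullet> wpoint R k = R\<^sup>2 * cos (real j * pi / 4 - real k * pi / 4)"
  "zpoint R j \<bullet> wpoint R k = 0" "wpoint R j \<bullet> zpoint R k = 0"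
  by (simp_all add: zpoint_def wpoint_def inner_complex_def cos_diff power2_eq_square algebra_simps)

text \<open>
  Vertices at most two steps apart on an octagon enclose at most a right angle. This covers all
  tetrahedra that occur below.
\<close>
lemma inner_point_nonneg:
  assumes "j \<le> k + 2" "k \<le> j + 2"
  shows "0 \<le> zpoint R j \<bullet> zpoint R k" "0 \<le> wpoint R j \<bullet> wpoint R k"
proof -
  have "real j \<le> real k + 2" "real k \<le> real j + 2"
    using assms by linarith+
  then have "(real j - real k) * pi \<le> 2 * pi" "(real k - real j) * pi \<le> 2 * pi"
    by (intro mult_right_mono; simp)+
  then have "0 \<le> cos (real j * pi / 4 - real k * pi / 4)"
    by (intro cos_ge_zero) (auto simp: algebra_simps)
  then show "0 \<le> zpoint R j \<bullet> zpoint R k" "0 \<le> wpoint R j \<bullet> wpoint R k"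
    by (simp_all add: inner_point)
qed

text \<open>
  The sum of the four points has inner product at least \<open>16 r\<^sup>2\<close> with each of them, and norm at
  most \<open>16 r\<close>, so a half-space separates their convex hull from the ball of radius \<open>r\<close>.
\<close>
lemma acute_hull_far:
  fixes a b c d :: "'a::real_inner"
  assumes "\<forall>p\<in>{a, b, c, d}. norm p = 4 * r"
    and "\<forall>p\<in>{a, b, c, d}. \<forall>q\<in>{a, b, c, d}. 0 \<le> p \<bullet> q" and "0 < r"
  obtains S where "convex S" "{a, b, c, d} \<subseteq> S" "\<And>x. x \<in> S \<Longrightarrow> r \<le> norm x"
proof
  let ?u = "a + b + c + d"
  let ?S = "{x. ?u \<bullet> x \<ge> 16 * r\<^sup>2}"
  show "convex ?S"
    by (rule convex_halfspace_ge)
  have "p \<bullet> p = 16 * r\<^sup>2" if "p \<in> {a, b, c, d}" for p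
    using bspec [OF assms(1) that] by (simp add: dot_square_norm power_mult_distrib)
  then show "{a, b, c, d} \<subseteq> ?S"
    using assms(2) by (fastforce simp: inner_add_left)
  fix x
  assume x: "x \<in> ?S"
  have "norm ?u \<le> norm a + norm b + norm c + norm d"
    by norm
  then have "norm ?u \<le> 16 * r"
    using assms(1) by simp
  then have "16 * r\<^sup>2 \<le> 16 * r * norm x"
    using x norm_cauchy_schwarz [of ?u x] mult_right_mono [of "norm ?u" "16 * r" "norm x"] by auto
  then show "r \<le> norm x"
    using \<open>0 < r\<close> by (simp add: power2_eq_square)
qed

text \<open>
  Write \<open>A k\<close> and \<open>B k\<close> for the vertices of the two octagons. The group has four orbits on the 64
  tetrahedra of the join, represented by \<open>A\<^sub>0 A\<^sub>1 B\<^sub>4 B\<^sub>5\<close>, \<open>A\<^sub>0 A\<^sub>1 B\<^sub>5 B\<^sub>6\<close>,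
  \<open>A\<^sub>0 A\<^sub>1 B\<^sub>6 B\<^sub>7\<close> and \<open>A\<^sub>1 A\<^sub>2 B\<^sub>6 B\<^sub>7\<close>. Singular simplices have ordered vertices, and no
  choice of orders makes the glued faces of these four agree as ordered triangles. Replacing the
  last two by the other three faces of the 4-simplex \<open>A\<^sub>0 A\<^sub>1 A\<^sub>2 B\<^sub>6 B\<^sub>7\<close> repairs this: the
  twenty faces of the five tetrahedra coincide in ten pairs, as ordered triangles, up to
  the group. The same holds for the cones over them with apex \<open>0\<close>.
\<close>
lemma equivariant_labelling_rainbow_point:
  fixes lab :: "complex \<times> complex \<Rightarrow> nat"
  assumes le4: "\<And>q. lab q \<le> 4"
    and turn: "\<And>q. lab (turn q) = turn_label (lab q)"
    and flip: "\<And>q. lab (flip q) = flip_label (lab q)"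
    and zero: "lab 0 = 4"
    and far: "\<And>q. r \<le> norm q \<Longrightarrow> lab q \<noteq> 4" and "0 < r"
  obtains q where "\<And>U i. open U \<Longrightarrow> q \<in> U \<Longrightarrow> i \<le> 4 \<Longrightarrow> \<exists>y\<in>U. lab y = i"
proof (rule ccontr)
  assume "\<not> thesis"
  define \<U> where "\<U> = {U. open U \<and> (\<exists>i\<le>4. \<forall>y\<in>U. lab y \<noteq> i)}"
  have "\<exists>U\<in>\<U>. q \<in> U" for q
  proof (rule ccontr)
    assume "\<not> (\<exists>U\<in>\<U>. q \<in> U)"
    then have "\<exists>y\<in>U. lab y = i" if "open U" "q \<in> U" "i \<le> 4" for U i
      using that unfolding \<U>_def by blast
    then have thesis
      by (rule that)
    with \<open>\<not> thesis\<close> show False ..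
  qed
  then have cover: "topspace euclidean \<subseteq> \<Union>\<U>"
    by auto
  (* At radius 4 r the tetrahedra below stay outside the ball of radius r, by acute_hull_far. *)
  define A where "A = zpoint (4 * r)"
  define B where "B = wpoint (4 * r)"
  have moves: "turn (A k) = A (Suc k)" "turn (B (Suc k)) = B k" "flip (A k) = B k"
      "flip (B k) = A (k + 4)" "A (k + 8) = A k" "B (k + 8) = B k" for k
    unfolding A_def B_def
    by (simp_all only: turn_zpoint turn_wpoint flip_zpoint flip_wpoint point_period)
  have norms: "norm (A k) = 4 * r" "norm (B k) = 4 * r" for k
    using \<open>0 < r\<close> by (simp_all add: A_def B_def)
  have inner0: "A j \<bullet> B k = 0" "B j \<bullet> A k = 0" for j k
    by (simp_all add: A_def B_def inner_point)
  have inner_nonneg: "0 \<le> A j \<bullet> A k" "0 \<le> B j \<bullet> B k" if "j \<le> k + 2" "k \<le> j + 2" for j k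
    using inner_point_nonneg [OF that] by (simp_all add: A_def B_def)
  (* The parity contributed by the cone with apex 0 over an ordered triangle. *)
  define V where "V n p q s \<longleftrightarrow> even (homotopy_count lab 3 n (frag_of (vertex_simplex [0, p, q, s])))" for n p q s
  have sing3: "singular_chain 3 euclidean (frag_of (vertex_simplex [p1, p2, p3, p4]))" for p1 p2 p3 p4 :: "complex \<times> complex"
    using singular_chain_simplex [of UNIV "[p1, p2, p3, p4]" 3] by simp
  have sing4: "singular_chain 4 euclidean (frag_of (vertex_simplex [p0, p1, p2, p3, p4]))"
    for p0 p1 p2 p3 p4 :: "complex \<times> complex"
    using singular_chain_simplex [of UNIV "[p0, p1, p2, p3, p4]" 4] by simp
  have bij: "bij_betw turn_label {..Suc 3} {..Suc 3}" "bij_betw flip_label {..Suc 3} {..Suc 3}"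
    using bij_turn_label bij_flip_label by simp_all
  have V_map: "V n (g p) (g q) (g s) = V n p q s"
    if "linear g" "\<And>q. lab (g q) = \<pi> (lab q)" "bij_betw \<pi> {..Suc 3} {..Suc 3}" for n p q s g \<pi>
    using homotopy_count_chain_map [of lab g \<pi> 3 _ "frag_of (vertex_simplex [0, p, q, s])" n, OF that(2,3) _ sing3] le4
      simplex_map_simplex [OF that(1), of "[0, p, q, s]" 3] linear_0 [OF that(1)]
    by (simp add: V_def)
  have V_turn: "V n (turn p) (turn q) (turn s) = V n p q s" for n p q s
    by (rule V_map [OF linear_turn turn bij(1)])
  have V_flip: "V n (flip p) (flip q) (flip s) = V n p q s" for n p q s
    by (rule V_map [OF linear_flip flip bij(2)])
  (* The base opposite to the apex is far from 0, where the label 4 does not occur. *)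
  have face: "even (homotopy_count lab 3 n (chain_boundary 4 (frag_of (vertex_simplex [0, a, b, c, d]))))
              \<longleftrightarrow> ((V n b c d \<longleftrightarrow> V n a c d) \<longleftrightarrow> (V n a b d \<longleftrightarrow> V n a b c))"
    if norm4: "\<forall>p\<in>{a, b, c, d}. norm p = 4 * r" and acute: "\<forall>p\<in>{a, b, c, d}. \<forall>q\<in>{a, b, c, d}. 0 \<le> p \<bullet> q" for n a b c d
  proof -
    obtain S where S: "convex S" "{a, b, c, d} \<subseteq> S" "\<And>x. x \<in> S \<Longrightarrow> r \<le> norm x"
      by (rule acute_hull_far [OF norm4 acute \<open>0 < r\<close>]) (rule that)
    have "homotopy_count lab 3 n (frag_of (vertex_simplex [a, b, c, d])) = 0"
      by (rule homotopy_count_missing_label [of 3 S _ 4]) (use S far in \<open>auto intro!: singular_chain_simplex\<close>)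
    then show ?thesis
      unfolding chain_boundary_simplex V_def
      by (auto simp: Modules.additive.add [OF additive_homotopy_count] Modules.additive.diff [OF additive_homotopy_count])
  qed
  define c where "c = frag_of (vertex_simplex [0, A 0, A 1, B 4, B 5]) + frag_of (vertex_simplex [0, A 0, A 1, B 5, B 6])
    + frag_of (vertex_simplex [0, A 0, A 1, B 6, A 2]) + frag_of (vertex_simplex [0, A 0, B 6, B 7, A 2])
    + frag_of (vertex_simplex [0, A 0, B 7, A 1, A 2])"
  have c: "singular_chain 4 euclidean c"
    unfolding c_def
    by (intro singular_chain_add sing4)
  have images: "turn (A 0) = A 1" "turn (A 1) = A 2" "turn (B 1) = B 0" "turn (B 0) = B 7" "turn (B 7) = B 6"
    "turn (B 6) = B 5" "turn (B 5) = B 4" "flip (A 0) = B 0" "flip (A 1) = B 1"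
    "flip (B 4) = A 0" "flip (B 5) = A 1"
    using moves(1) [of 0] moves(1) [of 1] moves(2) [of 0] moves(2) [of 7] moves(2) [of 6] moves(2) [of 5]
      moves(2) [of 4] moves(3) [of 0] moves(3) [of 1] moves(4) [of 4] moves(4) [of 5]
      moves(5) [of 0] moves(5) [of 1] moves(6) [of 0]
    by (simp_all add: numeral_2_eq_2)
  have even_boundary: "even (homotopy_count lab 3 n (chain_boundary 4 c))" for n
  proof -
    (* The five pairs of faces of c that agree only up to the group; the other five coincide. *)
    have glue: "V n (A 1) (B 4) (B 5) = V n (A 0) (B 5) (B 6)"
      "V n (A 0) (B 4) (B 5) = V n (B 7) (A 1) (A 2)"
      "V n (A 0) (A 1) (B 4) = V n (B 6) (B 7) (A 2)"
      "V n (A 1) (B 5) (B 6) = V n (A 0) (B 6) (B 7)"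
      "V n (A 1) (B 6) (A 2) = V n (A 0) (B 7) (A 1)"
      using V_turn [of n "A 0" "B 5" "B 6"] V_turn [of n "A 0" "B 6" "B 7"] V_turn [of n "A 0" "B 7" "A 1"]
        V_flip [of n "A 0" "B 4" "B 5"] V_turn [of n "B 0" "A 0" "A 1"]
        V_flip [of n "A 0" "A 1" "B 4"] V_turn [of n "B 0" "B 1" "A 0"] V_turn [of n "B 7" "B 0" "A 1"]
      unfolding images by simp_all
    show ?thesis
      unfolding c_def chain_boundary_add
      using glue
      by (simp add: Modules.additive.add [OF additive_homotopy_count] face norms inner0 inner_nonneg) argo
  qed
  have odd: "odd (rainbow_count lab 4 c)"
  proof -
    (* The label of one vertex determines those of its orbit, which leaves four cases. *)
    have "lab (A 0) < 4"
      using le4 [of "A 0"] far [of "A 0"] norms(1) [of 0] \<open>0 < r\<close> by simp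
    then have "lab (A 0) = 0 \<or> lab (A 0) = 1 \<or> lab (A 0) = 2 \<or> lab (A 0) = 3"
      by auto
    moreover have "lab (A 1) = turn_label (lab (A 0))" "lab (A 2) = turn_label (lab (A 1))"
      "lab (B 0) = flip_label (lab (A 0))" "lab (B 7) = turn_label (lab (B 0))"
      "lab (B 6) = turn_label (lab (B 7))" "lab (B 5) = turn_label (lab (B 6))"
      "lab (B 4) = turn_label (lab (B 5))"
      using images by (simp_all flip: turn flip)
    ultimately show ?thesis
      by (elim disjE)
        (simp_all add: c_def rainbow_count_add rainbow_count_simplex zero atMost_4 turn_label_def flip_label_def)
  qed
  show False
  proof (rule sufficient_iterated_singular_subdivision_exists [of \<U> euclidean 4 c])
    show "openin euclidean U" if "U \<in> \<U>" for U
      using that by (simp add: \<U>_def)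
    fix n
    assume n: "\<And>m s. \<lbrakk>n \<le> m; s \<in> Poly_Mapping.keys ((singular_subdivision 4 ^^ m) c)\<rbrakk>
                     \<Longrightarrow> \<exists>V \<in> \<U>. s \<in> standard_simplex 4 \<rightarrow> V"
    have "rainbow_count lab 4 ((singular_subdivision 4 ^^ n) c) = 0"
    proof (rule rainbow_count_eq_0)
      fix s
      assume "s \<in> Poly_Mapping.keys ((singular_subdivision 4 ^^ n) c)"
      then obtain U where "U \<in> \<U>" "s \<in> standard_simplex 4 \<rightarrow> U"
        using n [OF order_refl] by blast
      then obtain i where "i \<le> 4" and i: "\<forall>y\<in>U. lab y \<noteq> i"
        unfolding \<U>_def by blast
      have "s (vertex j) \<in> U" if "j \<le> 4" for j
        using \<open>s \<in> standard_simplex 4 \<rightarrow> U\<close> that by (simp add: Pi_iff)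
      then have "i \<notin> (\<lambda>j. lab (s (vertex j))) ` {..4}"
        using i by fastforce
      then show "\<not> rainbow 4 (\<lambda>j. lab (s (vertex j)))"
        using \<open>i \<le> 4\<close> unfolding rainbow_def by (meson atMost_iff subsetD)
    qed
    moreover have "odd (rainbow_count lab 4 ((singular_subdivision 4 ^^ n) c))"
      using even_rainbow_count_iterated_subdivision [of 3 euclidean c lab] c le4 even_boundary odd by simp
    ultimately show False
      by simp
  qed (use cover c in auto)
qed

section \<open>Cubes parametrised by quaternions\<close>

text \<open>
  The imaginary quaternion \<open>q v q\<^sup>*\<close> for \<open>q = z + w j\<close>, where \<open>v\<close> stands for
  \<open>v\<^sub>1 i + (v\<^sub>2 + v\<^sub>3 i) j\<close>.
\<close>
definition scaled_rotation :: "complex \<times> complex \<Rightarrow> real^3 \<Rightarrow> real^3" where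
  "scaled_rotation q v =
     (let z = fst q; w = snd q; c = Complex (v$2) (v$3);
          d = c * z\<^sup>2 + cnj c * w\<^sup>2 - 2 * \<i> * of_real (v$1) * z * w
      in vector [v$1 * ((cmod z)\<^sup>2 - (cmod w)\<^sup>2) + 2 * Im (c * z * cnj w), Re d, Im d])"

text \<open>
  In real coordinates this is the Euler-Rodrigues matrix, on which polynomial identities such as
  the multiplicativity of the norm can be checked directly.
\<close>
lemma scaled_rotation_coordinates:
  "scaled_rotation (Complex a b, Complex c d) v =
     vector [v$1 * (a\<^sup>2 + b\<^sup>2 - c\<^sup>2 - d\<^sup>2) + 2 * (v$2 * (b * c - a * d) + v$3 * (a * c + b * d)),
             v$2 * (a\<^sup>2 - b\<^sup>2 + c\<^sup>2 - d\<^sup>2) + v$3 * (2 * c * d - 2 * a * b) + v$1 * 2 * (a * d + b * c),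
             v$2 * 2 * (a * b + c * d) + v$3 * (a\<^sup>2 - b\<^sup>2 - c\<^sup>2 + d\<^sup>2) + v$1 * 2 * (b * d - a * c)]"
  by (simp add: scaled_rotation_def Let_def cmod_def power2_eq_square algebra_simps)

lemma linear_scaled_rotation: "linear (scaled_rotation q)"
proof (cases q)
  case (Pair z w)
  obtain a b c d where "z = Complex a b" "w = Complex c d"
    by (meson complex.exhaust)
  then show ?thesis
    unfolding Pair
    by (intro linearI) (simp_all add: scaled_rotation_coordinates vec_eq_iff forall_3 algebra_simps)
qed

lemma norm_scaled_rotation: "norm (scaled_rotation q v) = (norm q)\<^sup>2 * norm v"
proof -
  obtain z w where q: "q = (z, w)"
    by (cases q)
  obtain a b c d where zw: "z = Complex a b" "w = Complex c d"
    by (meson complex.exhaust)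
  have "(norm (scaled_rotation q v))\<^sup>2 = ((norm q)\<^sup>2 * norm v)\<^sup>2"
    unfolding q zw power_mult_distrib
    by (simp add: scaled_rotation_coordinates power2_norm_eq_inner inner_vec_def sum_3 norm_Pair cmod_def) algebra
  then show ?thesis
    by (rule power2_eq_imp_eq) simp_all
qed

lemma continuous_scaled_rotation: "continuous_on S (\<lambda>q. scaled_rotation q v)"
proof -
  have eq: "scaled_rotation q v = (v$1 * ((cmod (fst q))\<^sup>2 - (cmod (snd q))\<^sup>2) + 2 * Im (Complex (v$2) (v$3) * fst q * cnj (snd q))) *\<^sub>R axis 1 1
      + Re (Complex (v$2) (v$3) * (fst q)\<^sup>2 + cnj (Complex (v$2) (v$3)) * (snd q)\<^sup>2 - 2 * \<i> * of_real (v$1) * fst q * snd q) *\<^sub>R axis 2 1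
      + Im (Complex (v$2) (v$3) * (fst q)\<^sup>2 + cnj (Complex (v$2) (v$3)) * (snd q)\<^sup>2 - 2 * \<i> * of_real (v$1) * fst q * snd q) *\<^sub>R axis 3 1" for q
    unfolding scaled_rotation_def Let_def by (simp add: vec_eq_iff forall_3 axis_def)
  show ?thesis
    unfolding eq by (intro continuous_intros)
qed

text \<open>
  One vertex of the cube on each diagonal, in the cyclic order in which the quarter turn about the
  first axis permutes them.
\<close>
definition corner :: "nat \<Rightarrow> real^3" where
  "corner i = [vector [1, 1, 1], vector [1, -1, 1], vector [1, -1, -1], vector [1, 1, -1]] ! i"

lemma corner_simps [simp]:
  "corner 0 = vector [1, 1, 1]" "corner 1 = vector [1, -1, 1]"
  "corner (Suc 0) = vector [1, -1, 1]"
  "corner 2 = vector [1, -1, -1]" "corner 3 = vector [1, 1, -1]"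
  by (simp_all add: corner_def)

lemma less_4_cases: "i < 4 \<longleftrightarrow> i = 0 \<or> i = 1 \<or> i = 2 \<or> i = (3::nat)"
  by auto

lemma scaled_rotation_turn: "i < 4 \<Longrightarrow> scaled_rotation (turn q) (corner (turn_label i)) = scaled_rotation q (corner i)"
proof -
  assume i: "i < 4"
  let ?\<omega> = "cis (pi / 4)" and ?\<omega>' = "cis (- (pi / 4))"
  have *: "?\<omega> * ?\<omega> = \<i>" "?\<omega>' * ?\<omega>' = - \<i>" "?\<omega> * ?\<omega>' = 1"
    by (simp_all add: cis_mult)
  have "cnj ?\<omega>' = ?\<omega>"
    by (simp add: cis_cnj)
  obtain z w where q: "q = (z, w)"
    by (cases q)
  have sq: "(?\<omega> * z)\<^sup>2 = \<i> * z\<^sup>2" "(?\<omega>' * w)\<^sup>2 = - \<i> * w\<^sup>2"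
    using * unfolding power_mult_distrib power2_eq_square [of ?\<omega>] power2_eq_square [of ?\<omega>'] by simp_all
  have "c * (?\<omega> * z) * (?\<omega>' * w) = c * z * w * (?\<omega> * ?\<omega>')" for c
    by (simp only: mult_ac)
  then have zw: "c * (?\<omega> * z) * (?\<omega>' * w) = c * z * w" for c
    using * by simp
  have "c * (?\<omega> * z) * cnj (?\<omega>' * w) = (?\<omega> * ?\<omega>) * c * z * cnj w" for c
    by (simp add: \<open>cnj ?\<omega>' = ?\<omega>\<close>)
  then have zcw: "c * (?\<omega> * z) * cnj (?\<omega>' * w) = \<i> * c * z * cnj w" for c
    using * by simp
  have "scaled_rotation (turn q) v = scaled_rotation q (vector [v$1, - (v$3), v$2])" for v
    unfolding scaled_rotation_def turn_def q fst_conv snd_conv Let_def sq zw zcw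
    by (simp add: vec_eq_iff forall_3 norm_mult algebra_simps)
  with i show ?thesis
    by (auto simp: less_4_cases turn_label_def)
qed

lemma scaled_rotation_flip: "i < 4 \<Longrightarrow> scaled_rotation (flip q) (corner (flip_label i)) = - scaled_rotation q (corner i)"
proof -
  assume i: "i < 4"
  obtain z w where q: "q = (z, w)"
    by (cases q)
  obtain a b c d where zw: "z = Complex a b" "w = Complex c d"
    by (meson complex.exhaust)
  have "flip q = (Complex (-c) (-d), Complex a b)"
    by (simp add: flip_def q zw complex_eq_iff)
  then have "scaled_rotation (flip q) v = scaled_rotation q (vector [- (v$1), v$2, - (v$3)])" for v
    unfolding q zw by (simp add: scaled_rotation_coordinates vec_eq_iff forall_3 algebra_simps)
  moreover have "- scaled_rotation q (corner i) = scaled_rotation q (- corner i)"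
    using linear_neg [OF linear_scaled_rotation] by metis
  moreover have "(vector [- (corner (flip_label i)$1), corner (flip_label i)$2, - (corner (flip_label i)$3)] :: real^3) = - corner i"
    using i by (auto simp: less_4_cases flip_label_def vec_eq_iff forall_3)
  ultimately show ?thesis
    by simp
qed

lemma corner_inject:
  assumes "i < 4" "j < 4" "corner i = corner j \<or> corner i = - corner j"
  shows "i = j"
  using assms by (auto simp: less_4_cases vec_eq_iff forall_3)

lemma inj_scaled_rotation: "q \<noteq> 0 \<Longrightarrow> inj (scaled_rotation q)"
  using linear_injective_0 [OF linear_scaled_rotation] norm_scaled_rotation [of q] by (metis mult_eq_0_iff norm_eq_zero power_eq_0_iff)

lemma norm_corner: "i < 4 \<Longrightarrow> 1 \<le> norm (corner i)"
  using component_le_norm_cart [of "corner i" 1] by (auto simp: less_4_cases)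

text \<open>
  A point of the cube with a coordinate of modulus less than \<open>1 / 2\<close> is the midpoint of a segment
  in the cube parallel to that axis, and injective linear maps preserve open segments.
\<close>
lemma extreme_point_of_linear_image_cube:
  fixes R :: "real^'n \<Rightarrow> real^'m"
  assumes "linear R" "inj R" and y: "y extreme_point_of (R ` cbox (\<chi> i. - 1 / 2) (\<chi> i. 1 / 2))"
  obtains x where "y = R x" "\<And>i. \<bar>x $ i\<bar> = 1 / 2"
proof -
  let ?Q = "cbox (\<chi> i. - 1 / 2) (\<chi> i. 1 / 2) :: (real^'n) set"
  from y obtain x where x: "x \<in> ?Q" "y = R x"
    by (auto simp: extreme_point_of_def)
  have bounds: "- (1 / 2) \<le> x $ i" "x $ i \<le> 1 / 2" for i
    using x(1) by (auto simp: mem_box_cart)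
  have "\<bar>x $ i\<bar> = 1 / 2" for i
  proof (rule ccontr)
    assume "\<bar>x $ i\<bar> \<noteq> 1 / 2"
    moreover have "\<bar>x $ i\<bar> \<le> 1 / 2"
      using bounds [of i] by linarith
    ultimately have less: "\<bar>x $ i\<bar> < 1 / 2"
      by simp
    define t where "t = 1 / 2 - \<bar>x $ i\<bar>"
    define a where "a = x - t *\<^sub>R axis i 1"
    define b where "b = x + t *\<^sub>R axis i 1"
    have "- (1 / 2) \<le> a $ j \<and> a $ j \<le> 1 / 2 \<and> - (1 / 2) \<le> b $ j \<and> b $ j \<le> 1 / 2" for j
      using bounds [of j] by (auto simp: a_def b_def axis_def t_def abs_if)
    then have "a \<in> ?Q" "b \<in> ?Q"
      by (simp_all add: mem_box_cart)
    then have "R a \<in> R ` ?Q" "R b \<in> R ` ?Q"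
      by blast+
    moreover have "R x \<in> open_segment (R a) (R b)"
    proof -
      have "t \<noteq> 0"
        using less by (simp add: t_def)
      then have "a $ i \<noteq> b $ i"
        by (simp add: a_def b_def axis_def)
      then have "a \<noteq> b"
        by auto
      moreover have "x = midpoint a b"
        by (simp add: midpoint_def a_def b_def scaleR_2 [symmetric])
      ultimately have "x \<in> open_segment a b"
        by (simp add: midpoint_in_open_segment)
      then show ?thesis
        using open_segment_linear_image [OF assms(1,2)] by blast
    qed
    ultimately show False
      using y unfolding extreme_point_of_def x(2) by (elim conjE) (drule (1) bspec, drule (1) bspec, erule (1) notE)
  qed
  with x(2) that show ?thesis
    by blast
qed


lemma cube_with_corners_on_set:
  assumes "q \<noteq> 0" and sym: "\<And>x. x \<in> M \<Longrightarrow> - x \<in> M" and M: "\<And>i. i < 4 \<Longrightarrow> scaled_rotation q (corner i) \<in> M"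
  shows "\<exists>C. cube_centred_at 0 C \<and> vertices C \<subseteq> M"
proof -
  define n where "n = (norm q)\<^sup>2"
  have "n > 0"
    using assms(1) by (simp add: n_def)
  (* The form of the map in the definition of a cube; the edge length is twice the scaling factor
     because the corners have coordinates of modulus 1 rather than 1/2. *)
  define R where "R x = 0 + (2 * n) *\<^sub>R ((1 / n) *\<^sub>R scaled_rotation q x)" for x
  have R: "R x = 2 *\<^sub>R scaled_rotation q x" for x
    using \<open>n > 0\<close> by (simp add: R_def)
  let ?C = "R ` cbox (\<chi> i. - 1 / 2) (\<chi> i. 1 / 2)"
  have orth: "orthogonal_transformation (\<lambda>x. (1 / n) *\<^sub>R scaled_rotation q x)"
    unfolding orthogonal_transformation
    using \<open>n > 0\<close> linear_compose_scale_right [OF linear_scaled_rotation] by (simp add: norm_scaled_rotation n_def)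
  then have "cube_centred_at 0 ?C"
    unfolding cube_centred_at_def R_def [abs_def] using \<open>n > 0\<close>
    by (intro exI [of _ "2 * n"] exI [of _ "\<lambda>x. (1 / n) *\<^sub>R scaled_rotation q x"] conjI orth refl) simp
  moreover have "vertices ?C \<subseteq> M"
  proof
    fix y
    assume "y \<in> vertices ?C"
    then have "y extreme_point_of ?C"
      by (simp add: vertices_def)
    moreover have "linear R" "inj R"
      unfolding R [abs_def] using inj_scaled_rotation [OF assms(1)]
      by (auto intro: linear_compose_scale_right linear_scaled_rotation simp: inj_def)
    ultimately obtain x where x: "y = R x" "\<And>i. \<bar>x $ i\<bar> = 1 / 2"
      using extreme_point_of_linear_image_cube by metis
    have "y = scaled_rotation q (2 *\<^sub>R x)"
      using x(1) linear_cmul [OF linear_scaled_rotation] by (simp add: R)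
    moreover have "\<exists>i<4. 2 *\<^sub>R x = corner i \<or> 2 *\<^sub>R x = - corner i"
    proof -
      have "x $ i = 1 / 2 \<or> x $ i = - (1 / 2)" for i
        using x(2) [of i] by linarith
      from this [of 1] this [of 2] this [of 3] show ?thesis
        unfolding less_4_cases ex_disj_distrib conj_disj_distribR simp_thms
        by (elim disjE) (simp_all add: vec_eq_iff forall_3)
    qed
    ultimately show "y \<in> M"
      using M sym linear_neg [OF linear_scaled_rotation [of q]] by metis
  qed
  ultimately show ?thesis
    by blast
qed

section \<open>Cubes on which an even function vanishes\<close>

text \<open>\<open>p\<close> is a vertex of the cube of \<open>q\<close>, and lies on its diagonal number \<open>i\<close>.\<close>
definition corner_index :: "nat \<Rightarrow> real^3 \<Rightarrow> complex \<times> complex \<Rightarrow> bool" where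
  "corner_index i p q \<longleftrightarrow> i < 4 \<and> (p = scaled_rotation q (corner i) \<or> p = - scaled_rotation q (corner i))"

lemma corner_index_unique:
  assumes "corner_index i p q" "corner_index j p q" "q \<noteq> 0"
  shows "i = j"
proof -
  have "scaled_rotation q (corner i) = scaled_rotation q (corner j) \<or> scaled_rotation q (corner i) = scaled_rotation q (- corner j)"
    using assms(1,2) linear_neg [OF linear_scaled_rotation [of q]] unfolding corner_index_def
    by (metis minus_minus)
  then have "corner i = corner j \<or> corner i = - corner j"
    using inj_scaled_rotation [OF assms(3)] by (auto dest: injD)
  then show ?thesis
    using assms(1,2) corner_inject unfolding corner_index_def by blast
qed

lemma label_less_4: "i < 4 \<Longrightarrow> turn_label i < 4" "i < 4 \<Longrightarrow> flip_label i < 4"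
  by (auto simp: turn_label_def flip_label_def)

lemma corner_index_turn: "corner_index i p q \<Longrightarrow> corner_index (turn_label i) p (turn q)"
  unfolding corner_index_def by (auto simp: scaled_rotation_turn label_less_4)

lemma corner_index_flip: "corner_index i p q \<Longrightarrow> corner_index (flip_label i) p (flip q)"
  unfolding corner_index_def by (auto simp: scaled_rotation_flip label_less_4)

lemma ex_corner_index_turn: "(\<exists>i. corner_index i p (turn q)) \<longleftrightarrow> (\<exists>i. corner_index i p q)"
proof
  assume "\<exists>i. corner_index i p (turn q)"
  then obtain i where i: "i < 4" "p = scaled_rotation (turn q) (corner i) \<or> p = - scaled_rotation (turn q) (corner i)"
    unfolding corner_index_def by blast
  then obtain j where "j < 4" "turn_label j = i"
    using bij_turn_label unfolding less_4_cases turn_label_def by (elim disjE; force)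
  then show "\<exists>i. corner_index i p q"
    using i unfolding corner_index_def by (metis scaled_rotation_turn)
qed (blast dest: corner_index_turn)

lemma ex_corner_index_flip: "(\<exists>i. corner_index i p (flip q)) \<longleftrightarrow> (\<exists>i. corner_index i p q)"
proof
  assume "\<exists>i. corner_index i p (flip q)"
  then obtain i where i: "i < 4" "p = scaled_rotation (flip q) (corner i) \<or> p = - scaled_rotation (flip q) (corner i)"
    unfolding corner_index_def by blast
  moreover from i(1) have "flip_label (flip_label i) = i" "flip_label i < 4"
    by (auto simp: flip_label_def less_4_cases)
  ultimately show "\<exists>i. corner_index i p q"
    unfolding corner_index_def by (metis scaled_rotation_flip minus_minus)
qed (blast dest: corner_index_flip)

text \<open>
  The choice depends on \<open>q\<close> only through the set of vertices of its cube. Since \<open>turn\<close> and \<open>flip\<close>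
  do not change this set, the chosen vertex is the same for all points of an orbit; only the
  index of its diagonal changes.
\<close>
definition positive_corner :: "(real^3 \<Rightarrow> real) \<Rightarrow> complex \<times> complex \<Rightarrow> real^3" where
  "positive_corner \<phi> q = (SOME p. 0 < \<phi> p \<and> (\<exists>i. corner_index i p q))"

definition corner_label :: "(real^3 \<Rightarrow> real) \<Rightarrow> complex \<times> complex \<Rightarrow> nat" where
  "corner_label \<phi> q =
     (if \<exists>p. 0 < \<phi> p \<and> (\<exists>i. corner_index i p q) then THE i. corner_index i (positive_corner \<phi> q) q else 4)"

text \<open>
  The cube degenerates at \<open>q = 0\<close>, where a vertex has no well-defined diagonal. The hypothesis on
  \<open>\<phi> 0\<close> puts this point into the first case.
\<close>
lemma corner_label_cases:
  assumes "\<phi> 0 \<le> 0"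
  obtains "\<forall>i<4. \<phi> (scaled_rotation q (corner i)) \<le> 0" "corner_label \<phi> q = 4" "\<not> (\<exists>p. 0 < \<phi> p \<and> (\<exists>i. corner_index i p q))"
  | "q \<noteq> 0" "corner_label \<phi> q < 4" "corner_index (corner_label \<phi> q) (positive_corner \<phi> q) q"
      "0 < \<phi> (positive_corner \<phi> q)" "\<exists>p. 0 < \<phi> p \<and> (\<exists>i. corner_index i p q)"
proof (cases "\<exists>p. 0 < \<phi> p \<and> (\<exists>i. corner_index i p q)")
  case False
  have "\<phi> (scaled_rotation q (corner i)) \<le> 0" if "i < 4" for i
  proof -
    have "corner_index i (scaled_rotation q (corner i)) q"
      using that by (simp add: corner_index_def)
    with False show ?thesis
      by (meson not_less)
  qed
  moreover have "corner_label \<phi> q = 4"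
    by (simp only: corner_label_def False if_False)
  ultimately show ?thesis
    using False by (intro that(1)) blast+
next
  case True
  then have "0 < \<phi> (positive_corner \<phi> q) \<and> (\<exists>i. corner_index i (positive_corner \<phi> q) q)"
    unfolding positive_corner_def by (rule someI_ex)
  then have pos: "0 < \<phi> (positive_corner \<phi> q)" and ex: "\<exists>i. corner_index i (positive_corner \<phi> q) q"
    by blast+
  have "q \<noteq> 0"
    using ex pos assms norm_scaled_rotation [of 0] unfolding corner_index_def by auto
  then have unique: "\<exists>!i. corner_index i (positive_corner \<phi> q) q"
    using ex corner_index_unique by blast
  have "corner_index (corner_label \<phi> q) (positive_corner \<phi> q) q"
    unfolding corner_label_def if_P [OF True] by (rule theI' [OF unique])
  then show ?thesis
    using that(2) True pos \<open>q \<noteq> 0\<close> corner_index_def by blast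
qed

lemma corner_label_equivariant:
  assumes "\<phi> 0 \<le> 0" "\<And>p. (\<exists>i. corner_index i p (g q)) \<longleftrightarrow> (\<exists>i. corner_index i p q)"
    and "\<And>i p. corner_index i p q \<Longrightarrow> corner_index (\<pi> i) p (g q)" "\<pi> 4 = 4"
  shows "corner_label \<phi> (g q) = \<pi> (corner_label \<phi> q)"
proof -
  have same: "positive_corner \<phi> (g q) = positive_corner \<phi> q"
    unfolding positive_corner_def assms(2) ..
  show ?thesis
  proof (cases rule: corner_label_cases [of \<phi> q, OF assms(1)])
    case 1
    have "\<not> (\<exists>p. 0 < \<phi> p \<and> (\<exists>i. corner_index i p (g q)))"
      unfolding assms(2) by (rule 1(3))
    then have "corner_label \<phi> (g q) = 4"
      by (simp only: corner_label_def if_False)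
    with 1(2) assms(4) show ?thesis
      by simp
  next
    case 2
    then have "corner_index (\<pi> (corner_label \<phi> q)) (positive_corner \<phi> q) (g q)"
      using assms(3) by blast
    moreover have "g q \<noteq> 0" "corner_index (corner_label \<phi> (g q)) (positive_corner \<phi> q) (g q)"
      using 2 assms(2) by (auto intro: corner_label_cases [of \<phi> "g q", OF assms(1)] simp flip: same)
    ultimately show ?thesis
      using corner_index_unique by blast
  qed
qed

text \<open>
  At a point where all five labels accumulate, the label \<open>4\<close> gives \<open>\<phi> \<le> 0\<close> on the whole cube, and
  the label \<open>i\<close> gives \<open>\<phi> \<ge> 0\<close> on the diagonal \<open>i\<close>, by continuity.
\<close>
proposition even_function_vanishes_on_cube:
  fixes \<phi> :: "real^3 \<Rightarrow> real"
  assumes cont: "continuous_on UNIV \<phi>" and even: "\<And>x. \<phi> (- x) = \<phi> x"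
    and neg: "\<phi> 0 < 0" and pos: "\<And>x. B \<le> norm x \<Longrightarrow> 0 < \<phi> x"
  obtains q where "q \<noteq> 0" "\<And>i. i < 4 \<Longrightarrow> \<phi> (scaled_rotation q (corner i)) = 0"
proof -
  have "\<phi> 0 \<le> 0"
    using neg by simp
  note cases = corner_label_cases [of \<phi>, OF this]
  have idx: "\<exists>i. corner_index i (scaled_rotation q (corner j)) q" if "j < 4" for j q
    using that corner_index_def by blast
  obtain q where q: "\<And>U i. open U \<Longrightarrow> q \<in> U \<Longrightarrow> i \<le> 4 \<Longrightarrow> \<exists>y\<in>U. corner_label \<phi> y = i"
  proof (rule equivariant_labelling_rainbow_point [of "corner_label \<phi>" "max 1 B"])
    show "corner_label \<phi> q \<le> 4" for q
      by (cases rule: cases [of q]) auto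
    show "corner_label \<phi> (turn q) = turn_label (corner_label \<phi> q)" for q
      by (rule corner_label_equivariant [of \<phi> turn q turn_label, OF \<open>\<phi> 0 \<le> 0\<close> ex_corner_index_turn corner_index_turn])
        (auto simp: turn_label_def)
    show "corner_label \<phi> (flip q) = flip_label (corner_label \<phi> q)" for q
      by (rule corner_label_equivariant [of \<phi> flip q flip_label, OF \<open>\<phi> 0 \<le> 0\<close> ex_corner_index_flip corner_index_flip])
        (auto simp: flip_label_def)
    show "corner_label \<phi> 0 = 4"
      by (cases rule: cases [of 0]) auto
    show "corner_label \<phi> q \<noteq> 4" if q: "max 1 B \<le> norm q" for q
    proof -
      have "norm q * 1 \<le> norm q * norm q"
        using q by (intro mult_left_mono) auto
      moreover have "(norm q)\<^sup>2 * 1 \<le> (norm q)\<^sup>2 * norm (corner 0)"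
        using norm_corner [of 0] by (intro mult_left_mono) auto
      ultimately have "B \<le> norm (scaled_rotation q (corner 0))"
        using q unfolding norm_scaled_rotation power2_eq_square by simp
      then have "0 < \<phi> (scaled_rotation q (corner 0))"
        by (rule pos)
      then have "\<not> (\<forall>i<4. \<phi> (scaled_rotation q (corner i)) \<le> 0)"
        by (metis not_le zero_less_numeral)
      then show ?thesis
        by (cases rule: cases [of q]) auto
    qed
  qed auto
  have "\<phi> (scaled_rotation q (corner i)) = 0" if i: "i < 4" for i
  proof -
    have cont': "continuous_on UNIV (\<lambda>y. \<phi> (scaled_rotation y (corner i)))"
      by (rule continuous_on_compose2 [OF cont continuous_scaled_rotation]) auto
    have "\<not> 0 < \<phi> (scaled_rotation q (corner i))"
    proof
      assume "0 < \<phi> (scaled_rotation q (corner i))"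
      moreover have "open {y. 0 < \<phi> (scaled_rotation y (corner i))}"
        using cont' by (intro open_Collect_less continuous_intros)
      ultimately obtain y where "0 < \<phi> (scaled_rotation y (corner i))" "corner_label \<phi> y = 4"
        using q [of "{y. 0 < \<phi> (scaled_rotation y (corner i))}" 4] by auto
      then show False
        using i by (cases rule: cases [of y]) (auto simp: not_le [symmetric])
    qed
    moreover have "\<not> \<phi> (scaled_rotation q (corner i)) < 0"
    proof
      assume "\<phi> (scaled_rotation q (corner i)) < 0"
      moreover have "open {y. \<phi> (scaled_rotation y (corner i)) < 0}"
        using cont' by (intro open_Collect_less continuous_intros)
      ultimately obtain y where y: "\<phi> (scaled_rotation y (corner i)) < 0" "corner_label \<phi> y = i"
        using q [of "{y. \<phi> (scaled_rotation y (corner i)) < 0}" i] i by auto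
      show False
      proof (cases rule: cases [of y])
        case 2
        then have "\<phi> (positive_corner \<phi> y) = \<phi> (scaled_rotation y (corner i))"
          using y(2) even unfolding corner_index_def by auto
        then show False
          using 2 y(1) by simp
      qed (use y(2) i in simp)
    qed
    ultimately show ?thesis
      by simp
  qed
  moreover from this [of 0] have "q \<noteq> 0"
    using neg norm_scaled_rotation [of 0 "corner 0"] by auto
  ultimately show ?thesis
    using that by blast
qed

section \<open>The inside of the surface\<close>

lemma C1_on_imp_continuous_on:
  assumes "C1_on S f"
  shows "continuous_on S f"
  unfolding continuous_on_eq_continuous_within
proof
  fix x
  assume "x \<in> S"
  then obtain U F F' where U: "open U" "x \<in> U" "\<forall>y\<in>U. (F has_derivative blinfun_apply (F' y)) (at y)"
      "\<forall>y\<in>U \<inter> S. F y = f y"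
    using assms unfolding C1_on_def by (metis (no_types))
  then have "continuous (at x within S) F"
    using has_derivative_continuous continuous_at_imp_continuous_at_within by blast
  moreover have "\<forall>\<^sub>F y in at x within S. f y = F y"
    unfolding eventually_at_topological using U by (metis IntI)
  ultimately show "continuous (at x within S) f"
    using U \<open>x \<in> S\<close> by (metis IntI continuous_within tendsto_cong)
qed

text \<open>
  Were the component of \<open>0\<close> unbounded, the radial projection of the image of \<open>f\<close> would be
  null-homotopic by Borsuk's criterion. Composing with \<open>f\<close> and normalising \<open>H\<close> would contract the
  sphere.
\<close>
lemma bounded_inside_of_sphere_homotopic_to_identity:
  fixes f :: "'a::euclidean_space \<Rightarrow> 'a" and H :: "'a \<times> real \<Rightarrow> 'a"
  assumes "continuous_on (sphere 0 1 \<times> {0..1}) H"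
    and "\<And>u t. u \<in> sphere 0 1 \<Longrightarrow> t \<in> {0..1} \<Longrightarrow> H (u, t) \<noteq> 0"
    and "\<And>u. u \<in> sphere 0 1 \<Longrightarrow> H (u, 0) = f u"
    and "\<And>u. u \<in> sphere 0 1 \<Longrightarrow> H (u, 1) = u"
  shows "bounded (connected_component_set (- f ` sphere 0 1) 0)"
proof -
  let ?S = "sphere (0::'a) 1"
  let ?g = "\<lambda>x::'a. inverse (norm (x - 0)) *\<^sub>R (x - 0)"
  have contf: "continuous_on ?S f"
  proof -
    have "continuous_on ?S (\<lambda>u. H (u, 0))"
      by (rule continuous_on_compose2 [OF assms(1)]) (auto intro!: continuous_intros)
    then show ?thesis
      by (rule continuous_on_eq) (use assms(3) in auto)
  qed
  then have "compact (f ` ?S)"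
    by (intro compact_continuous_image) auto
  moreover have "0 \<notin> f ` ?S"
    using assms(2) [of _ 0] assms(3) by auto
  moreover have "\<not> (\<exists>c. homotopic_with_canon (\<lambda>x. True) (f ` ?S) (sphere 0 1) ?g (\<lambda>x. c))"
  proof
    assume "\<exists>c. homotopic_with_canon (\<lambda>x. True) (f ` ?S) (sphere 0 1) ?g (\<lambda>x. c)"
    then obtain c where "homotopic_with_canon (\<lambda>x. True) (f ` ?S) ?S ?g (\<lambda>x. c)"
      by blast
    then have "homotopic_with_canon (\<lambda>x. True) ?S ?S (?g \<circ> f) ((\<lambda>x. c) \<circ> f)"
      by (rule homotopic_with_compose_continuous_right [OF _ contf]) auto
    moreover have "homotopic_with_canon (\<lambda>x. True) ?S ?S id (?g \<circ> f)"
    proof (rule homotopic_with_symD, subst homotopic_with, simp, intro exI conjI)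
      let ?h = "\<lambda>(t, u). ?g (H (u, t))"
      have "continuous_on ({0..1} \<times> ?S) (\<lambda>p. H (snd p, fst p))"
        by (rule continuous_on_compose2 [OF assms(1)]) (auto intro!: continuous_intros)
      then have "continuous_on ({0..1} \<times> ?S) ?h"
        unfolding split_def using assms(2) by (intro continuous_intros) auto
      moreover have "?h \<in> {0..1} \<times> ?S \<rightarrow> ?S"
        using assms(2) by auto
      ultimately show "continuous_map (prod_topology (top_of_set {0..1}) (top_of_set ?S)) (top_of_set ?S) ?h"
        by auto
    qed (use assms(3,4) in auto)
    ultimately have "homotopic_with_canon (\<lambda>x. True) ?S ?S id (\<lambda>x. c)"
      using homotopic_with_trans by (fastforce simp: o_def)
    then have "contractible ?S"
      unfolding contractible_def by blast
    then show False
      by (simp add: contractible_sphere)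
  qed
  ultimately show ?thesis
    using Borsuk_map_essential_bounded_component [of "f ` ?S" 0] by blast
qed

text \<open>
  The function is the distance to the component \<open>K\<close> of \<open>0\<close> minus the distance to its complement. It
  vanishes only on the frontier of \<open>K\<close>, which lies in \<open>M\<close>; it is even because \<open>-K\<close> is again the
  component of \<open>0\<close>.
\<close>
lemma even_function_of_inside:
  fixes M :: "'a::euclidean_space set"
  assumes "compact M" "0 \<notin> M" "\<And>x. x \<in> M \<Longrightarrow> - x \<in> M" "bounded (connected_component_set (- M) 0)"
  obtains \<phi> :: "'a \<Rightarrow> real" and B where "continuous_on UNIV \<phi>" "\<And>x. \<phi> (- x) = \<phi> x" "\<phi> 0 < 0"
    "\<And>x. B \<le> norm x \<Longrightarrow> 0 < \<phi> x" "\<And>x. \<phi> x = 0 \<Longrightarrow> x \<in> M"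
proof -
  define K where "K = connected_component_set (- M) 0"
  have "0 \<in> K"
    using assms(2) by (simp add: K_def)
  have "closed M"
    using assms(1) by (rule compact_imp_closed)
  then have "open K"
    unfolding K_def by (simp add: open_Compl open_connected_component)
  have "K \<noteq> UNIV"
    using assms(4) not_bounded_UNIV unfolding K_def by metis
  have "uminus ` K \<subseteq> K"
  proof -
    have "connected (uminus ` K)"
      unfolding K_def by (intro connected_continuous_image continuous_intros connected_connected_component)
    moreover have "uminus ` K \<subseteq> - M"
      using connected_component_subset [of "- M" 0] assms(3) unfolding K_def by (metis (no_types, lifting) ComplD ComplI image_subsetI in_mono minus_minus)
    moreover have "0 \<in> uminus ` K"
      using \<open>0 \<in> K\<close> by force
    ultimately show ?thesis
      unfolding K_def by (intro connected_component_maximal) auto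
  qed
  then have sym: "- x \<in> K \<longleftrightarrow> x \<in> K" for x
    by (metis image_subset_iff minus_minus)
  have frontier: "frontier K \<subseteq> M"
    using frontier_of_connected_component_subset [of "- M" 0] \<open>closed M\<close> frontier_subset_closed [of M]
    unfolding K_def by auto
  define \<phi> where "\<phi> x = infdist x K - infdist x (- K)" for x
  have inf_sym: "infdist (- x) T = infdist x T" if "\<And>y. - y \<in> T \<longleftrightarrow> y \<in> T" for x and T :: "'a set"
  proof -
    have "uminus ` T = T"
      using that by force
    then have "infdist (- x) T = infdist (- x) (uminus ` T)"
      by simp
    also have "\<dots> = infdist x T"
      by (simp add: infdist_def image_image dist_minus)
    finally show ?thesis .
  qed
  have "bounded (closure K)"
    using assms(4) bounded_closure unfolding K_def by blast
  then obtain B where B: "\<forall>x\<in>closure K. norm x < B"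
    unfolding bounded_pos_less by blast
  have neg: "\<phi> x < 0" if "x \<in> K" for x
    using that \<open>open K\<close> \<open>K \<noteq> UNIV\<close> infdist_pos_not_in_closed [of "- K" x]
    by (simp add: \<phi>_def closed_Compl Compl_eq_Diff_UNIV) blast
  have nonneg: "\<phi> x = infdist x K" if "x \<notin> K" for x
    using that by (simp add: \<phi>_def)
  show ?thesis
  proof
    show "continuous_on UNIV \<phi>"
      unfolding \<phi>_def by (intro continuous_intros)
    show "\<phi> (- x) = \<phi> x" for x
      unfolding \<phi>_def using sym by (simp add: inf_sym)
    show "\<phi> 0 < 0"
      using neg \<open>0 \<in> K\<close> .
    have pos: "0 < \<phi> x" if "x \<notin> closure K" for x
      using that nonneg [of x] closure_subset [of K] in_closure_iff_infdist_zero [of K x] \<open>0 \<in> K\<close>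
        infdist_nonneg [of x K] by force
    show "0 < \<phi> x" if "B \<le> norm x" for x
      using pos [of x] B that by force
    show "x \<in> M" if "\<phi> x = 0" for x
    proof -
      have "x \<notin> K" "x \<in> closure K"
        using neg [of x] pos [of x] that by auto
      then show ?thesis
        using frontier \<open>open K\<close> by (auto simp: frontier_def interior_open)
    qed
  qed
qed

section \<open>Inscribed cubes\<close>

theorem theorem2:
  fixes f :: "real^3 \<Rightarrow> real^3"
    and H :: "(real^3) \<times> real \<Rightarrow> real^3"
  assumes "C1_embedding_sphere f"
    and "\<And>u. u \<in> sphere 0 1 \<Longrightarrow> f (- u) = - f u"
    and "C1_on (sphere 0 1 \<times> {0..1}) H"
    and "\<And>u t. u \<in> sphere 0 1 \<Longrightarrow> t \<in> {0..1} \<Longrightarrow> H (u, t) \<noteq> 0"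
    and "\<And>u. u \<in> sphere 0 1 \<Longrightarrow> H (u, 0) = f u"
    and "\<And>u. u \<in> sphere 0 1 \<Longrightarrow> H (u, 1) = u"
    and "\<And>u t. u \<in> sphere 0 1 \<Longrightarrow> t \<in> {0..1} \<Longrightarrow> H (- u, t) = - H (u, t)"
  shows "\<exists>C. cube_centred_at 0 C \<and> vertices C \<subseteq> f ` sphere 0 1"
proof -
  let ?M = "f ` sphere 0 1"
  have "continuous_on (sphere 0 1) f"
    using assms(1) C1_on_imp_continuous_on unfolding C1_embedding_sphere_def by blast
  then have compact: "compact ?M"
    by (intro compact_continuous_image) auto
  have nonzero: "0 \<notin> ?M"
    using assms(4) [of _ 0] assms(5) by auto
  have sym: "- x \<in> ?M" if "x \<in> ?M" for x
  proof -
    from that obtain u where "u \<in> sphere 0 1" "x = f u"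
      by blast
    then show ?thesis
      using assms(2) [of u] by (intro image_eqI [of _ _ "- u"]) auto
  qed
  have bounded: "bounded (connected_component_set (- ?M) 0)"
    by (rule bounded_inside_of_sphere_homotopic_to_identity [OF C1_on_imp_continuous_on [OF assms(3)] assms(4,5,6)])
  show ?thesis
  proof (rule even_function_of_inside [OF compact nonzero sym bounded])
    fix \<phi> :: "real^3 \<Rightarrow> real" and B :: real
    assume \<phi>: "continuous_on UNIV \<phi>" "\<And>x. \<phi> (- x) = \<phi> x" "\<phi> 0 < 0" "\<And>x. B \<le> norm x \<Longrightarrow> 0 < \<phi> x"
      and zero: "\<And>x. \<phi> x = 0 \<Longrightarrow> x \<in> ?M"
    show ?thesis
    proof (rule even_function_vanishes_on_cube [of \<phi> B])
      fix q
      assume q: "q \<noteq> 0" "\<And>i. i < 4 \<Longrightarrow> \<phi> (scaled_rotation q (corner i)) = 0"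
      show ?thesis
        by (rule cube_with_corners_on_set [OF q(1) sym zero [OF q(2)]])
    qed (use \<phi> in auto)
  qed
qed

end
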